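(* Let $\mathcal{H}(\mathbb{C}^{\mathbb{N}})$ be the space of entire functions on $\mathbb{C}^{\mathbb{N}}$, endowed with a topology $\tau$ which is either $\tau_0$ or $\tau_\delta$. Then: (a) No convolution operator on $(\mathcal{H}(\mathbb{C}^{\mathbb{N}}),\tau)$ is cyclic. (b) No convolution operator on $(\mathcal{H}(\mathbb{C}^{\mathbb{N}}),\tau)$ is $n$-supercyclic, for any $n\in\mathbb{N}$.
   Context: $\mathbb{N}=\{1,2,3,\ldots\}$ and $\mathbb{N}_0=\mathbb{N}\cup\{0\}$. $\mathbb{C}^{\mathbb{N}}=\prod_{n=1}^\infty\mathbb{C}$ carries the product topology. $\mathcal{H}(\mathbb{C}^{\mathbb{N}})$ is the complex vector space of all entire functions $f\colon\mathbb{C}^{\mathbb{N}}\to\mathbb{C}$ (holomorphic on the whole locally convex space $\mathbb{C}^{\mathbb{N}}$, i.e. continuous and holomorphic along every complex affine line); $\mathcal{H}(\mathbb{C}^n)$ is the space of entire functions on $\mathbb{C}^n$ with the compact-open topology. Topologies: $\tau_0$ is the compact-open topology on $\mathcal{H}(\mathbb{C}^{\mathbb{N}})$, and $\tau_\delta$ is its associated bornological topology. Equivalently, $\tau_\delta$ is the locally convex inductive limit topology, i.e. the strongest locally convex topology on $\mathcal{H}(\mathbb{C}^{\mathbb{N}})$ making all the maps $\pi_n^*\colon \mathcal{H}(\mathbb{C}^n)\to\mathcal{H}(\mathbb{C}^{\mathbb{N}})$, $\pi_n^*(g)=g\circ\pi_n$ ($n\in\mathbb{N}$), continuous, where $\pi_n\colon\mathbb{C}^{\mathbb{N}}\to\mathbb{C}^n$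 is the projection onto the first $n$ coordinates. For $\xi\in\mathbb{C}^{\mathbb{N}}$ the translation operator $\tau_\xi$ on $\mathcal{H}(\mathbb{C}^{\mathbb{N}})$ is $(\tau_\xi f)(x)=f(x-\xi)$. A convolution operator on $(\mathcal{H}(\mathbb{C}^{\mathbb{N}}),\tau)$ is a continuous linear map $L\colon\mathcal{H}(\mathbb{C}^{\mathbb{N}})\to\mathcal{H}(\mathbb{C}^{\mathbb{N}})$ such that $L(\tau_\xi f)=\tau_\xi(Lf)$ for every $f\in\mathcal{H}(\mathbb{C}^{\mathbb{N}})$ and $\xi\in\mathbb{C}^{\mathbb{N}}$. Let $T$ be a continuous linear operator on a Hausdorff topological complex vector space $E$. $T$ is cyclic if there is $x\in E$ such that the linear span of $\{T^kx:k\in\mathbb{N}_0\}$ is dense in $E$. $T$ is $n$-supercyclic if there is a vector subspace $V\subset E$ of dimension $n$ such that $\bigcup_{k=0}^\infty T^k(V)$ is dense in $E$. *)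

theory Defs
  imports "HOL-Analysis.Analysis"
begin

text \<open>The scalar multiplication is an explicit parameter \<open>s\<close>, the topology is a value
  \<open>T\<close> on the whole type; linearity, span and dimension are those of
  \<^locale>\<open>vector_space\<close>.\<close>

definition absorbs :: "(complex \<Rightarrow> 'a \<Rightarrow> 'a) \<Rightarrow> 'a set \<Rightarrow> 'a set \<Rightarrow> bool" where
  "absorbs s W B \<longleftrightarrow> (\<exists>r>0. \<forall>c. r \<le> cmod c \<longrightarrow> B \<subseteq> s c ` W)"

definition vn_bounded :: "(complex \<Rightarrow> 'a::ab_group_add \<Rightarrow> 'a) \<Rightarrow> 'a topology \<Rightarrow> 'a set \<Rightarrow> bool" where
  "vn_bounded s T B \<longleftrightarrow> (\<forall>U. openin T U \<and> 0 \<in> U \<longrightarrow> absorbs s U B)"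

definition absolutely_convex :: "(complex \<Rightarrow> 'a::ab_group_add \<Rightarrow> 'a) \<Rightarrow> 'a set \<Rightarrow> bool" where
  "absolutely_convex s W \<longleftrightarrow>
     (\<forall>x\<in>W. \<forall>y\<in>W. \<forall>a b. cmod a + cmod b \<le> 1 \<longrightarrow> s a x + s b y \<in> W)"

definition bornivorous :: "(complex \<Rightarrow> 'a::ab_group_add \<Rightarrow> 'a) \<Rightarrow> 'a topology \<Rightarrow> 'a set \<Rightarrow> bool" where
  "bornivorous s T W \<longleftrightarrow> (\<forall>B. vn_bounded s T B \<longrightarrow> absorbs s W B)"

text \<open>The bornological topology associated with \<open>T\<close>: the locally convex topology for which
  the absolutely convex sets absorbing all \<open>T\<close>-bounded sets form a neighbourhood base at 0.\<close>

definition assoc_bornological ::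
    "(complex \<Rightarrow> 'a::ab_group_add \<Rightarrow> 'a) \<Rightarrow> 'a topology \<Rightarrow> 'a topology" where
  "assoc_bornological s T = topology (\<lambda>U. \<forall>x\<in>U. \<exists>W.
     absolutely_convex s W \<and> bornivorous s T W \<and> (\<forall>w\<in>W. x + w \<in> U))"

lemma absorbs_Int:
  assumes inj: "\<And>c. c \<noteq> 0 \<Longrightarrow> inj (s c)" and "absorbs s V B" "absorbs s W B"
  shows "absorbs s (V \<inter> W) B"
proof -
  obtain p q where pq: "p > 0" "q > 0"
    "\<And>c. p \<le> cmod c \<Longrightarrow> B \<subseteq> s c ` V" "\<And>c. q \<le> cmod c \<Longrightarrow> B \<subseteq> s c ` W"
    using assms(2,3) unfolding absorbs_def by blast
  have "B \<subseteq> s c ` (V \<inter> W)" if "max p q \<le> cmod c" for c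
  proof -
    have "c \<noteq> 0" using that pq(1) by auto
    then show ?thesis using pq(3)[of c] pq(4)[of c] that by (simp add: image_Int[OF inj])
  qed
  then show ?thesis unfolding absorbs_def using pq(1) by (intro exI[of _ "max p q"]) auto
qed

lemma openin_assoc_bornological:
  assumes "vector_space s"
  shows "openin (assoc_bornological s T) U \<longleftrightarrow> (\<forall>x\<in>U. \<exists>W.
     absolutely_convex s W \<and> bornivorous s T W \<and> (\<forall>w\<in>W. x + w \<in> U))"
proof -
  interpret vector_space s by fact
  have inj: "inj (s c)" if "c \<noteq> 0" for c
    using that by (simp add: inj_on_def)
  let ?P = "\<lambda>U. \<forall>x\<in>U. \<exists>W. absolutely_convex s W \<and> bornivorous s T W \<and> (\<forall>w\<in>W. x + w \<in> U)"
  have "?P (U \<inter> V)" if U: "?P U" and V: "?P V" for U V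
  proof
    fix x assume x: "x \<in> U \<inter> V"
    obtain W where W: "absolutely_convex s W" "bornivorous s T W" "\<forall>w\<in>W. x + w \<in> U"
      using U x by blast
    obtain Z where Z: "absolutely_convex s Z" "bornivorous s T Z" "\<forall>w\<in>Z. x + w \<in> V"
      using V x by blast
    have "absolutely_convex s (W \<inter> Z)"
      using W(1) Z(1) unfolding absolutely_convex_def by blast
    moreover have "bornivorous s T (W \<inter> Z)"
      using W(2) Z(2) absorbs_Int[of s, OF inj] unfolding bornivorous_def by blast
    ultimately show "\<exists>W. absolutely_convex s W \<and> bornivorous s T W \<and> (\<forall>w\<in>W. x + w \<in> U \<inter> V)"
      using W(3) Z(3) by blast
  qed
  moreover have "?P (\<Union>\<K>)" if "\<forall>K\<in>\<K>. ?P K" for \<K>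
    using that by (meson Union_iff)
  ultimately have "istopology ?P" unfolding istopology_def by blast
  then show ?thesis unfolding assoc_bornological_def by (simp add: topology_inverse')
qed

definition cyclic_operator ::
    "(complex \<Rightarrow> 'a::ab_group_add \<Rightarrow> 'a) \<Rightarrow> 'a topology \<Rightarrow> ('a \<Rightarrow> 'a) \<Rightarrow> bool" where
  "cyclic_operator s T L \<longleftrightarrow>
     (\<exists>x. T closure_of (module.span s (range (\<lambda>k. (L ^^ k) x))) = topspace T)"

text \<open>\<^const>\<open>vector_space.dim\<close> is 0 on infinite-dimensional subspaces, so the dimension
  condition is only meaningful for \<open>n \<ge> 1\<close>.\<close>

definition supercyclic_operator ::
    "nat \<Rightarrow> (complex \<Rightarrow> 'a::ab_group_add \<Rightarrow> 'a) \<Rightarrow> 'a topology \<Rightarrow> ('a \<Rightarrow> 'a) \<Rightarrow> bool" where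
  "supercyclic_operator n s T L \<longleftrightarrow>
     (\<exists>V. module.subspace s V \<and> vector_space.dim s V = n \<and>
          T closure_of (\<Union>k. (L ^^ k) ` V) = topspace T)"

text \<open>Sequences are indexed from 0. The type \<^typ>\<open>nat \<Rightarrow> complex\<close> carries the product
  topology.\<close>

definition entire :: "((nat \<Rightarrow> complex) \<Rightarrow> complex) \<Rightarrow> bool" where
  "entire f \<longleftrightarrow> continuous_on UNIV f \<and>
     (\<forall>a b. (\<lambda>z. f (\<lambda>i. a i + z * b i)) holomorphic_on UNIV)"

typedef entire_fun = "{f. entire f}"
  morphisms eval_at Abs_entire_fun
  by (rule exI[of _ "\<lambda>_. 0"]) (simp add: entire_def)

setup_lifting type_definition_entire_fun

instantiation entire_fun :: ab_group_add
begin

lift_definition zero_entire_fun :: entire_fun is "\<lambda>_. 0"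
  by (simp add: entire_def)

lift_definition plus_entire_fun :: "entire_fun \<Rightarrow> entire_fun \<Rightarrow> entire_fun" is
  "\<lambda>f g x. f x + g x"
  by (auto simp: entire_def intro!: continuous_intros holomorphic_intros)

lift_definition minus_entire_fun :: "entire_fun \<Rightarrow> entire_fun \<Rightarrow> entire_fun" is
  "\<lambda>f g x. f x - g x"
  by (auto simp: entire_def intro!: continuous_intros holomorphic_intros)

lift_definition uminus_entire_fun :: "entire_fun \<Rightarrow> entire_fun" is "\<lambda>f x. - f x"
  by (auto simp: entire_def intro!: continuous_intros holomorphic_intros)

instance
  by standard (transfer; auto simp: fun_eq_iff)+

end

lift_definition scaleE :: "complex \<Rightarrow> entire_fun \<Rightarrow> entire_fun" is "\<lambda>c f x. c * f x"
  by (auto simp: entire_def intro!: continuous_intros holomorphic_intros)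

lemma vector_space_scaleE: "vector_space scaleE"
  by unfold_locales (transfer; auto simp: fun_eq_iff algebra_simps)+

lift_definition translate :: "(nat \<Rightarrow> complex) \<Rightarrow> entire_fun \<Rightarrow> entire_fun" is
  "\<lambda>\<xi> f x. f (\<lambda>i. x i - \<xi> i)"
proof -
  fix \<xi> :: "nat \<Rightarrow> complex" and f assume f: "entire f"
  have "continuous_on UNIV (\<lambda>x. f (\<lambda>i. x i - \<xi> i))"
  proof (rule continuous_on_compose2[of UNIV f])
    show "continuous_on UNIV f" using f by (simp add: entire_def)
    show "continuous_on UNIV (\<lambda>x i. x i - \<xi> i)"
      by (intro continuous_on_coordinatewise_then_product continuous_intros
          continuous_on_product_coordinates)
  qed auto
  moreover have "(\<lambda>z. f (\<lambda>i. a i + z * b i - \<xi> i)) holomorphic_on UNIV" for a b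
  proof -
    have "(\<lambda>z. f (\<lambda>i. (a i - \<xi> i) + z * b i)) holomorphic_on UNIV"
      using f unfolding entire_def by (elim conjE allE[of _ "\<lambda>i. a i - \<xi> i"] allE[of _ b])
    then show ?thesis by (simp add: algebra_simps)
  qed
  ultimately show "entire (\<lambda>x. f (\<lambda>i. x i - \<xi> i))" by (simp add: entire_def)
qed

definition compact_open :: "entire_fun topology" where
  "compact_open = topology_generated_by
     {{f. eval_at f ` K \<subseteq> V} | K V. compact K \<and> open V}"

definition tau_delta :: "entire_fun topology" where
  "tau_delta = assoc_bornological scaleE compact_open"

definition convolution_operator ::
    "entire_fun topology \<Rightarrow> (entire_fun \<Rightarrow> entire_fun) \<Rightarrow> bool" where
  "convolution_operator T L \<longleftrightarrow>
     Vector_Spaces.linear scaleE scaleE L \<and> continuous_map T T L \<and>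
     (\<forall>\<xi> f. L (translate \<xi> f) = translate \<xi> (L f))"

end

theory Submission
  imports Defs "HOL-Complex_Analysis.Complex_Analysis"
begin

text \<open>The reason is that an entire function on \<open>\<complex>\<^sup>\<nat>\<close> depends on finitely many coordinates only
  (\<open>entire_fun_in_cylinder\<close>): continuity bounds it on a basic neighbourhood of 0, which restricts
  only finitely many coordinates, and Liouville's theorem makes it constant in the directions of
  all others. Depending only on the coordinates in \<open>I\<close> means being invariant under the
  translations by vectors that vanish on \<open>I\<close>, and a convolution operator commutes with these; so
  it maps the subspace \<open>cylinder I\<close> of such functions into itself. Therefore the orbit of one
  function, or of a finite-dimensional space of functions, stays in \<open>cylinder I\<close> for one
  finite \<open>I\<close>. This subspace is closed for both topologies, because evaluation at a point is
  continuous, and it is proper, because it misses the coordinate functions outside \<open>I\<close>. Hence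
  neither the orbit nor its span can be dense.\<close>

section \<open>Functions of a given set of coordinates\<close>

definition cylinder :: "nat set \<Rightarrow> entire_fun set" where
  "cylinder I = {f. \<forall>x y. (\<forall>i\<in>I. x i = y i) \<longrightarrow> eval_at f x = eval_at f y}"

lemma cylinder_mono: "I \<subseteq> J \<Longrightarrow> cylinder I \<subseteq> cylinder J"
  unfolding cylinder_def by blast

interpretation E: vector_space scaleE
  by (rule vector_space_scaleE)

lemma subspace_cylinder: "E.subspace (cylinder I)"
proof (rule E.subspaceI)
  show "0 \<in> cylinder I"
    by (simp add: cylinder_def zero_entire_fun.rep_eq)
  show "f + g \<in> cylinder I" if "f \<in> cylinder I" "g \<in> cylinder I" for f g
    unfolding cylinder_def
  proof (clarify, unfold plus_entire_fun.rep_eq)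
    fix x y :: "nat \<Rightarrow> complex" assume "\<forall>i\<in>I. x i = y i"
    then have "eval_at f x = eval_at f y" "eval_at g x = eval_at g y"
      using that by (auto simp: cylinder_def)
    then show "eval_at f x + eval_at g x = eval_at f y + eval_at g y"
      by simp
  qed
  show "scaleE c f \<in> cylinder I" if "f \<in> cylinder I" for c f
    unfolding cylinder_def
  proof (clarify, unfold scaleE.rep_eq)
    fix x y :: "nat \<Rightarrow> complex" assume "\<forall>i\<in>I. x i = y i"
    then have "eval_at f x = eval_at f y"
      using that by (auto simp: cylinder_def)
    then show "c * eval_at f x = c * eval_at f y"
      by simp
  qed
qed

section \<open>Entire functions depend on finitely many coordinates\<close>

text \<open>Liouville's theorem applies near 0 only, on a neighbourhood where \<open>f\<close> is bounded; the
  identity theorem on the lines through 0 carries the result to all points.\<close>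

lemma entire_depends_on_finitely_many:
  assumes "entire f"
  shows "\<exists>I. finite I \<and> (\<forall>x y. (\<forall>i\<in>I. x i = y i) \<longrightarrow> f x = f y)"
proof -
  have cont: "continuous_on UNIV f"
    and hol: "\<And>a b. (\<lambda>z. f (\<lambda>i. a i + z * b i)) holomorphic_on UNIV"
    using assms unfolding entire_def by auto
  define U where "U = f -` ball (f (\<lambda>_. 0)) 1"
  have "open U"
    using cont unfolding U_def by (simp add: continuous_on_open_vimage)
  then have "openin (product_topology (\<lambda>_. euclidean) UNIV) U"
    by (simp only: open_fun_def)
  moreover have "(\<lambda>_. 0) \<in> U"
    by (simp add: U_def)
  ultimately have "\<exists>X. (\<lambda>_. 0) \<in> Pi\<^sub>E UNIV X \<and> (\<forall>i. openin euclidean (X i)) \<and>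
      finite {i. X i \<noteq> topspace euclidean} \<and> Pi\<^sub>E UNIV X \<subseteq> U"
    by (rule product_topology_open_contains_basis)
  then obtain X where X: "(\<lambda>_. 0) \<in> Pi\<^sub>E UNIV X" "\<And>i. open (X i)"
      "finite {i. X i \<noteq> UNIV}" "Pi\<^sub>E UNIV X \<subseteq> U"
    unfolding open_openin[symmetric] topspace_euclidean by blast
  define I where "I = {i. X i \<noteq> UNIV}"
  have near: "f (\<lambda>i. a i + b i) = f a" if a: "a \<in> Pi\<^sub>E UNIV X" and b: "\<forall>i\<in>I. b i = 0" for a b
  proof -
    \<comment> \<open>Since \<open>b\<close> vanishes on \<open>I\<close>, the whole line through \<open>a\<close> in direction \<open>b\<close> stays in the
      neighbourhood on which \<open>f\<close> is bounded.\<close>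
    have "(\<lambda>i. a i + z * b i) \<in> Pi\<^sub>E UNIV X" for z
    proof (rule PiE_I)
      fix i show "a i + z * b i \<in> X i"
        using a b by (cases "i \<in> I") (auto simp: I_def)
    qed auto
    then have "(\<lambda>i. a i + z * b i) \<in> U" for z
      using X(4) by (rule subsetD[rotated])
    then have "f (\<lambda>i. a i + z * b i) \<in> ball (f (\<lambda>_. 0)) 1" for z
      by (simp only: U_def vimage_eq)
    then have "range (\<lambda>z. f (\<lambda>i. a i + z * b i)) \<subseteq> ball (f (\<lambda>_. 0)) 1"
      by blast
    then have "bounded (range (\<lambda>z. f (\<lambda>i. a i + z * b i)))"
      using bounded_ball bounded_subset by blast
    from Liouville_theorem[OF hol this] obtain c where "\<And>z. f (\<lambda>i. a i + z * b i) = c"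
      unfolding constant_on_def by auto
    from this[of 1] this[of 0] show ?thesis by simp
  qed
  have "f (\<lambda>i. a i + b i) = f a" if b: "\<forall>i\<in>I. b i = 0" for a b
  proof -
    \<comment> \<open>Along the line through 0 and \<open>a\<close>, the equation holds near 0, so it holds up to \<open>a\<close>
      by the identity theorem.\<close>
    define g where "g = (\<lambda>z. f (\<lambda>i. b i + z * a i) - f (\<lambda>i. 0 + z * a i))"
    define N where "N = (\<Inter>i\<in>I. (\<lambda>z. z * a i) -` X i)"
    have "open N"
      unfolding N_def using X(2,3)
      by (intro open_INT ballI open_vimage continuous_intros) (auto simp: I_def)
    have "0 \<in> N"
      using X(1) by (auto simp: N_def PiE_iff)
    have inX: "(\<lambda>i. z * a i) \<in> Pi\<^sub>E UNIV X" if "z \<in> N" for z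
      using that by (auto simp: N_def I_def PiE_iff)
    have "f (\<lambda>i. z * a i + b i) = f (\<lambda>i. z * a i)" if "z \<in> N" for z
      by (rule near[OF inX[OF that] b])
    then have gN: "g z = 0" if "z \<in> N" for z
      using that by (simp add: g_def add.commute[of "b _"])
    have "g holomorphic_on UNIV"
      unfolding g_def by (intro holomorphic_on_diff hol)
    then have "g 1 = 0"
      using analytic_continuation_open[of N UNIV g "\<lambda>_. 0" 1] \<open>open N\<close> \<open>0 \<in> N\<close> gN by auto
    then show ?thesis by (simp add: g_def add.commute)
  qed
  from this[of "\<lambda>i. y i - x i" x for x y]
  have "f x = f y" if "\<forall>i\<in>I. x i = y i" for x y
    using that by simp
  then show ?thesis
    using X(3) unfolding I_def by blast
qed

lemma entire_fun_in_cylinder: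
  obtains I where "finite I" "f \<in> cylinder I"
  using entire_depends_on_finitely_many[of "eval_at f"] eval_at[of f]
  unfolding cylinder_def by auto

lemma finite_subset_cylinder:
  assumes "finite B"
  obtains I where "finite I" "B \<subseteq> cylinder I"
proof -
  have "\<forall>f\<in>B. \<exists>I. finite I \<and> f \<in> cylinder I"
    using entire_fun_in_cylinder by metis
  then obtain J where J: "\<And>f. f \<in> B \<Longrightarrow> finite (J f)" "\<And>f. f \<in> B \<Longrightarrow> f \<in> cylinder (J f)"
    by metis
  have "B \<subseteq> cylinder (\<Union>f\<in>B. J f)"
    using J(2) cylinder_mono[of "J _" "\<Union>f\<in>B. J f"] by blast
  then show ?thesis
    using that J(1) assms by blast
qed

text \<open>The coordinate function of an index outside \<open>I\<close> is the witness.\<close>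

lemma cylinder_proper:
  assumes "finite I"
  shows "cylinder I \<noteq> UNIV"
proof -
  obtain j where j: "j \<notin> I"
    using assms ex_new_if_finite infinite_UNIV_nat by blast
  have "entire (\<lambda>x. x j)"
    by (auto simp: entire_def intro!: continuous_on_product_coordinates holomorphic_intros)
  then have ev: "eval_at (Abs_entire_fun (\<lambda>x. x j)) = (\<lambda>x. x j)"
    by (simp add: Abs_entire_fun_inverse)
  have "Abs_entire_fun (\<lambda>x. x j) \<notin> cylinder I"
  proof
    assume "Abs_entire_fun (\<lambda>x. x j) \<in> cylinder I"
    then have "(\<forall>i\<in>I. x i = y i) \<longrightarrow> x j = y j" for x y :: "nat \<Rightarrow> complex"
      unfolding cylinder_def mem_Collect_eq ev by blast
    from this[of "\<lambda>_. 0" "\<lambda>i. if i = j then 1 else 0"] show False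
      using j by (auto split: if_splits)
  qed
  then show ?thesis by blast
qed

section \<open>Cylinder subspaces are closed\<close>

lemma topspace_compact_open: "topspace compact_open = UNIV"
proof -
  \<comment> \<open>The subbasic set for the empty compact set is the whole space.\<close>
  have "UNIV \<in> {{f. eval_at f ` K \<subseteq> V} | K V. compact K \<and> open V}"
    by (intro CollectI exI[of _ "{}"]) auto
  then show ?thesis
    unfolding compact_open_def topology_generated_by_topspace by blast
qed

lemma continuous_eval_compact_open:
  "continuous_map compact_open euclidean (\<lambda>f. eval_at f x)"
proof -
  have "openin compact_open {f. eval_at f x \<in> V}" if "open V" for V
  proof -
    have "{f. eval_at f x \<in> V} \<in> {{f. eval_at f ` K \<subseteq> V} | K V. compact K \<and> open V}"
      using that by (intro CollectI exI[of _ "{x}"] exI[of _ V]) auto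
    then show ?thesis
      unfolding compact_open_def by (rule topology_generated_by_Basis)
  qed
  then show ?thesis
    by (simp add: continuous_map_def topspace_compact_open)
qed

lemma topspace_tau_delta: "topspace tau_delta = UNIV"
proof -
  have "f \<in> scaleE c ` UNIV" if "c \<noteq> 0" for c f
    using that by (intro image_eqI[of _ _ "scaleE (1 / c) f"]) auto
  then have "B \<subseteq> scaleE c ` UNIV" if "1 \<le> cmod c" for B c
    using that norm_zero by (metis not_one_le_zero subsetI)
  then have "absorbs scaleE UNIV B" for B
    unfolding absorbs_def by (intro exI[of _ 1]) simp
  then have "openin tau_delta UNIV"
    unfolding tau_delta_def openin_assoc_bornological[OF vector_space_scaleE]
    by (auto simp: absolutely_convex_def bornivorous_def)
  then show ?thesis
    by (simp add: openin_subset top.extremum_uniqueI)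
qed

text \<open>The preimage of a disc around 0 under an evaluation is absolutely convex, and it is a
  neighbourhood of 0 in the compact-open topology, so it absorbs every bounded set.\<close>

lemma continuous_eval_tau_delta:
  "continuous_map tau_delta euclidean (\<lambda>f. eval_at f x)"
proof -
  have "openin tau_delta {f. eval_at f x \<in> V}" if V: "open V" for V
    unfolding tau_delta_def openin_assoc_bornological[OF vector_space_scaleE]
  proof
    fix f assume "f \<in> {f. eval_at f x \<in> V}"
    then obtain e where e: "e > 0" "ball (eval_at f x) e \<subseteq> V"
      using V open_contains_ball by blast
    define W where "W = {w. eval_at w x \<in> ball 0 e}"
    have "absolutely_convex scaleE W"
      unfolding absolutely_convex_def
    proof (intro ballI allI impI)
      fix v w a b assume vw: "v \<in> W" "w \<in> W" and ab: "cmod a + cmod b \<le> 1"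
      define m where "m = max (cmod (eval_at v x)) (cmod (eval_at w x))"
      have "cmod (a * eval_at v x + b * eval_at w x)
          \<le> cmod a * cmod (eval_at v x) + cmod b * cmod (eval_at w x)"
        by (metis norm_mult norm_triangle_ineq)
      also have "\<dots> \<le> cmod a * m + cmod b * m"
        by (intro add_mono mult_left_mono) (auto simp: m_def)
      also have "\<dots> = (cmod a + cmod b) * m"
        by (simp add: distrib_right)
      also have "\<dots> \<le> 1 * m"
        using ab by (intro mult_right_mono) (auto simp: m_def max_def)
      also have "\<dots> < e"
        using vw by (auto simp: m_def W_def)
      finally show "scaleE a v + scaleE b w \<in> W"
        by (simp add: W_def plus_entire_fun.rep_eq scaleE.rep_eq)
    qed
    moreover have "bornivorous scaleE compact_open W"
    proof -
      have "openin compact_open W"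
        using openin_continuous_map_preimage[OF continuous_eval_compact_open, of "ball 0 e" x]
        by (simp add: W_def topspace_compact_open)
      moreover have "0 \<in> W"
        using e by (simp add: W_def zero_entire_fun.rep_eq)
      ultimately show ?thesis
        by (auto simp: bornivorous_def vn_bounded_def)
    qed
    moreover have "f + w \<in> {f. eval_at f x \<in> V}" if "w \<in> W" for w
      using that e(2) by (auto simp: W_def plus_entire_fun.rep_eq dist_norm)
    ultimately show "\<exists>W. absolutely_convex scaleE W \<and> bornivorous scaleE compact_open W \<and>
        (\<forall>w\<in>W. f + w \<in> {f. eval_at f x \<in> V})"
      by blast
  qed
  then show ?thesis
    by (simp add: continuous_map_def topspace_tau_delta)
qed

text \<open>Membership is a family of equations between point evaluations.\<close>

lemma closedin_cylinder:
  assumes eval: "\<And>x. continuous_map T euclidean (\<lambda>f. eval_at f x)" and top: "topspace T = UNIV"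
  shows "closedin T (cylinder I)"
proof -
  have "closedin T {f. eval_at f x = eval_at f y}" for x y
    using closedin_continuous_maps_eq[OF _ eval eval, of x y] by (simp add: top)
  then have "closedin T (\<Inter>(x, y)\<in>{(x, y). \<forall>i\<in>I. x i = y i}. {f. eval_at f x = eval_at f y})"
    by (intro closedin_Inter) auto
  moreover have "cylinder I =
      (\<Inter>(x, y)\<in>{(x, y). \<forall>i\<in>I. x i = y i}. {f. eval_at f x = eval_at f y})"
    unfolding cylinder_def by auto
  ultimately show ?thesis by simp
qed

section \<open>Convolution operators preserve cylinder subspaces\<close>

text \<open>This form of membership is what an operator commuting with translations respects.\<close>

lemma cylinder_iff_translate:
  "f \<in> cylinder I \<longleftrightarrow> (\<forall>\<xi>. (\<forall>i\<in>I. \<xi> i = 0) \<longrightarrow> translate \<xi> f = f)"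
proof
  assume f: "f \<in> cylinder I"
  show "\<forall>\<xi>. (\<forall>i\<in>I. \<xi> i = 0) \<longrightarrow> translate \<xi> f = f"
  proof (intro allI impI)
    fix \<xi> :: "nat \<Rightarrow> complex" assume "\<forall>i\<in>I. \<xi> i = 0"
    then have "eval_at (translate \<xi> f) x = eval_at f x" for x
      using f by (simp add: cylinder_def translate.rep_eq)
    then show "translate \<xi> f = f"
      by (metis eval_at_inject ext)
  qed
next
  assume inv: "\<forall>\<xi>. (\<forall>i\<in>I. \<xi> i = 0) \<longrightarrow> translate \<xi> f = f"
  show "f \<in> cylinder I"
    unfolding cylinder_def
  proof (intro CollectI allI impI)
    fix x y :: "nat \<Rightarrow> complex" assume "\<forall>i\<in>I. x i = y i"
    then have "translate (\<lambda>i. x i - y i) f = f"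
      using inv by simp
    then have "eval_at f x = eval_at (translate (\<lambda>i. x i - y i) f) x"
      by simp
    then show "eval_at f x = eval_at f y"
      by (simp add: translate.rep_eq)
  qed
qed

lemma convolution_operator_funpow_cylinder:
  assumes L: "convolution_operator T L" and f: "f \<in> cylinder I"
  shows "(L ^^ k) f \<in> cylinder I"
proof (induction k)
  case 0
  then show ?case using f by simp
next
  case (Suc k)
  have "translate \<xi> (L g) = L (translate \<xi> g)" for \<xi> g
    using L unfolding convolution_operator_def by simp
  with Suc show ?case
    by (simp add: cylinder_iff_translate)
qed

section \<open>Orbits are not dense\<close>

theorem theorem3p1:
  fixes T :: "entire_fun topology"
  assumes "T = compact_open \<or> T = tau_delta"
  shows "(\<nexists>L. convolution_operator T L \<and> cyclic_operator scaleE T L) \<and>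
         (\<forall>n\<ge>1. \<nexists>L. convolution_operator T L \<and> supercyclic_operator n scaleE T L)"
proof -
  have top: "topspace T = UNIV"
    using assms topspace_compact_open topspace_tau_delta by blast
  have "continuous_map T euclidean (\<lambda>f. eval_at f x)" for x
    using assms continuous_eval_compact_open continuous_eval_tau_delta by blast
  then have closed: "closedin T (cylinder I)" for I
    using closedin_cylinder top by blast
  have not_dense: "T closure_of S \<noteq> topspace T" if "S \<subseteq> cylinder I" "finite I" for S I
    using closure_of_minimal[OF that(1) closed] cylinder_proper[OF that(2)] top by auto
  show ?thesis
  proof (intro conjI allI impI notI; elim exE conjE)
    fix L assume L: "convolution_operator T L" and "cyclic_operator scaleE T L"
    then obtain f where dense: "T closure_of (E.span (range (\<lambda>k. (L ^^ k) f))) = topspace T"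
      unfolding cyclic_operator_def by blast
    obtain I where I: "finite I" "f \<in> cylinder I"
      by (rule entire_fun_in_cylinder)
    have "E.span (range (\<lambda>k. (L ^^ k) f)) \<subseteq> cylinder I"
      using convolution_operator_funpow_cylinder[OF L I(2)]
      by (intro E.span_minimal subspace_cylinder) auto
    then show False
      using not_dense I(1) dense by blast
  next
    fix n :: nat and L
    assume n: "1 \<le> n" and L: "convolution_operator T L" and "supercyclic_operator n scaleE T L"
    then obtain V where V: "E.dim V = n" "T closure_of (\<Union>k. (L ^^ k) ` V) = topspace T"
      unfolding supercyclic_operator_def by blast
    obtain B where B: "V \<subseteq> E.span B" "card B = E.dim V"
      using E.basis_exists by metis
    \<comment> \<open>An infinite set has cardinality 0, so \<open>n \<ge> 1\<close> forces the basis to be finite.\<close>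
    have "finite B"
      using B(2) V(1) n card.infinite by fastforce
    then obtain I where I: "finite I" "B \<subseteq> cylinder I"
      by (rule finite_subset_cylinder)
    have "V \<subseteq> cylinder I"
      using B(1) E.span_minimal[OF I(2) subspace_cylinder] by blast
    then have "(\<Union>k. (L ^^ k) ` V) \<subseteq> cylinder I"
      using convolution_operator_funpow_cylinder[OF L] by blast
    then show False
      using not_dense I(1) V(2) by blast
  qed
qed

end
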